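(* Let $\delta\in\mathbb{R}$ and consider the equation $\alpha^3-\alpha^2+\frac{4}{27}\delta=0$ in the real unknown $\alpha$. The number of distinct real solutions and their location are as follows. (1) If $\delta>1$, there is exactly one real solution, and it lies in $(-\infty,-\frac13)$. (2) If $\delta=1$, there are exactly two distinct real solutions, namely $\frac23$ and $-\frac13$. (3) If $0<\delta<1$, there are exactly three distinct real solutions $\alpha_1,\alpha_2,\alpha_3$, and they satisfy $0<\alpha_1<\frac23<\alpha_2<1$ and $\alpha_3\in(-\frac13,0)$. (4) If $\delta=0$, there are exactly two distinct real solutions, namely $0$ and $1$. (5) If $\delta<0$, there is exactly one real solution, and it lies in $(1,\infty)$. *)

theory Defs
  imports Complex_Main
begin

definition cubic_solutions :: "real \<Rightarrow> real set" where
  "cubic_solutions \<delta> = {\<alpha>. \<alpha> ^ 3 - \<alpha> ^ 2 + 4 / 27 * \<delta> = 0}"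

end

theory Submission
  imports Defs
begin

text \<open>
  With \<open>p(\<alpha>) = \<alpha>\<^sup>3 - \<alpha>\<^sup>2\<close> the equation reads \<open>p(\<alpha>) = - 4\<delta>/27\<close>. The function \<open>p\<close> is strictly
  increasing on \<open>(-\<infinity>, 0]\<close>, strictly decreasing on \<open>[0, 2/3]\<close> and strictly increasing on
  \<open>[2/3, \<infinity>)\<close>, so each branch contains at most one solution. The factorizations
  \<open>p(\<alpha>) = \<alpha>\<^sup>2 (\<alpha> - 1)\<close> and \<open>p(\<alpha>) + 4/27 = (\<alpha> - 2/3)\<^sup>2 (\<alpha> + 1/3)\<close> locate the solutions, and the
  intermediate value theorem provides them.
\<close>

text \<open>Reduces monotonicity on each branch to the sign of one quadratic factor.\<close>

lemma cubic_diff: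
  fixes x y :: real
  shows "(y^3 - y^2) - (x^3 - x^2) = (y - x) * (x^2 + x * y + y^2 - x - y)"
  by (simp add: algebra_simps power2_eq_square power3_eq_cube)

lemma cubic_strict_mono_nonpos:
  fixes x y :: real
  assumes "x < y" "y \<le> 0"
  shows "x^3 - x^2 < y^3 - y^2"
proof -
  have "0 \<le> x * y" using assms by (simp add: mult_nonpos_nonpos)
  moreover have "0 \<le> x^2" "0 \<le> y^2" by simp_all
  ultimately have "0 < x^2 + x * y + y^2 - x - y" using assms by linarith
  then have "0 < (y - x) * (x^2 + x * y + y^2 - x - y)" using assms by simp
  then show ?thesis using cubic_diff[of y x] by linarith
qed

lemma cubic_strict_antimono_middle:
  fixes x y :: real
  assumes "0 \<le> x" "x < y" "y \<le> 2/3"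
  shows "y^3 - y^2 < x^3 - x^2"
proof -
  \<comment> \<open>The mixed term is bounded through the smaller variable, so the three bounds make
    the quadratic factor at most \<open>(x - y) / 3\<close>, which is negative.\<close>
  have "x * x \<le> 2/3 * x" "y * y \<le> 2/3 * y" "y * x \<le> 2/3 * x"
    using assms by (intro mult_right_mono; linarith)+
  then have "x^2 + x * y + y^2 - x - y < 0"
    unfolding power2_eq_square mult.commute[of x y] using assms by linarith
  then have "(y - x) * (x^2 + x * y + y^2 - x - y) < 0"
    using assms by (simp add: mult_pos_neg)
  then show ?thesis using cubic_diff[of y x] by linarith
qed

lemma cubic_strict_mono_large:
  fixes x y :: real
  assumes "2/3 \<le> x" "x < y"
  shows "x^3 - x^2 < y^3 - y^2"
proof -
  \<comment> \<open>Here the mixed term goes with the larger variable: the quadratic factor is at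
    least \<open>(y - x) / 3\<close>.\<close>
  have "2/3 * x \<le> x * x" "2/3 * y \<le> y * y" "2/3 * y \<le> x * y"
    using assms by (intro mult_right_mono; linarith)+
  then have "0 < x^2 + x * y + y^2 - x - y"
    unfolding power2_eq_square using assms by linarith
  then have "0 < (y - x) * (x^2 + x * y + y^2 - x - y)" using assms by simp
  then show ?thesis using cubic_diff[of y x] by linarith
qed

lemma mem_cubic_solutions_iff:
  "\<alpha> \<in> cubic_solutions \<delta> \<longleftrightarrow> \<alpha>^3 - \<alpha>^2 = - (4 / 27 * \<delta>)"
  by (auto simp: cubic_solutions_def)

lemma mem_cubic_solutions_iff_zero:
  "\<alpha> \<in> cubic_solutions \<delta> \<longleftrightarrow> \<alpha>^2 * (\<alpha> - 1) = - (4 / 27 * \<delta>)"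
  by (simp add: mem_cubic_solutions_iff algebra_simps power2_eq_square power3_eq_cube)

lemma mem_cubic_solutions_iff_one:
  "\<alpha> \<in> cubic_solutions \<delta> \<longleftrightarrow> (\<alpha> - 2/3)^2 * (\<alpha> + 1/3) = 4 / 27 * (1 - \<delta>)"
proof -
  have "(\<alpha> - 2/3)^2 * (\<alpha> + 1/3) = \<alpha>^3 - \<alpha>^2 + 4/27"
    by (simp add: field_simps power2_eq_square power3_eq_cube)
  then show ?thesis by (auto simp: mem_cubic_solutions_iff)
qed

text \<open>Strict monotonicity makes the cubic injective on each branch. The branches are closed
  and cover the line, so a case split on them leaves no gap.\<close>

lemma cubic_solutions_unique:
  assumes "x \<in> cubic_solutions \<delta>" "y \<in> cubic_solutions \<delta>"
    and "x \<le> 0 \<and> y \<le> 0 \<or> x \<in> {0..2/3} \<and> y \<in> {0..2/3} \<or> 2/3 \<le> x \<and> 2/3 \<le> y"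
  shows "x = y"
proof -
  have eq: "x^3 - x^2 = y^3 - y^2"
    using assms(1,2) by (simp add: mem_cubic_solutions_iff)
  have "\<not> x < y"
    using assms(3) eq cubic_strict_mono_nonpos[of x y] cubic_strict_antimono_middle[of x y]
      cubic_strict_mono_large[of x y] by auto
  moreover have "\<not> y < x"
    using assms(3) eq cubic_strict_mono_nonpos[of y x] cubic_strict_antimono_middle[of y x]
      cubic_strict_mono_large[of y x] by auto
  ultimately show ?thesis by linarith
qed

text \<open>Intermediate value theorem; the disjunction serves increasing and decreasing branches
  alike.\<close>

lemma cubic_solution_between:
  fixes a b \<delta> :: real
  assumes "a \<le> b"
    and "a^3 - a^2 \<le> - (4 / 27 * \<delta>) \<and> - (4 / 27 * \<delta>) \<le> b^3 - b^2
      \<or> b^3 - b^2 \<le> - (4 / 27 * \<delta>) \<and> - (4 / 27 * \<delta>) \<le> a^3 - a^2"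
  obtains \<alpha> where "a \<le> \<alpha>" "\<alpha> \<le> b" "\<alpha> \<in> cubic_solutions \<delta>"
proof -
  have "\<exists>\<alpha>. a \<le> \<alpha> \<and> \<alpha> \<le> b \<and> \<alpha>^3 - \<alpha>^2 = - (4 / 27 * \<delta>)"
    using assms(2)
  proof
    assume "a^3 - a^2 \<le> - (4 / 27 * \<delta>) \<and> - (4 / 27 * \<delta>) \<le> b^3 - b^2"
    then show ?thesis
      using assms(1) by (intro IVT' continuous_intros) auto
  next
    assume "b^3 - b^2 \<le> - (4 / 27 * \<delta>) \<and> - (4 / 27 * \<delta>) \<le> a^3 - a^2"
    then show ?thesis
      using assms(1) by (intro IVT2' continuous_intros) auto
  qed
  then show thesis using that by (auto simp: mem_cubic_solutions_iff)
qed

text \<open>In \<open>mem_cubic_solutions_iff_one\<close> the right-hand side is negative, which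
  forces the factor next to the square to be negative. All solutions thus lie on the branch of
  nonpositive numbers.\<close>

lemma cubic_solutions_gt_one:
  assumes "\<delta> > 1"
  obtains \<alpha> where "cubic_solutions \<delta> = {\<alpha>}" "\<alpha> < - (1/3)"
proof -
  have loc: "x < - (1/3)" if "x \<in> cubic_solutions \<delta>" for x
  proof (rule ccontr)
    assume "\<not> x < - (1/3)"
    then have "0 \<le> (x - 2/3)^2 * (x + 1/3)" by simp
    then show False using that assms by (simp add: mem_cubic_solutions_iff_one)
  qed
  \<comment> \<open>The left endpoint \<open>- \<delta>\<close> is far enough out: the cubic there
    is at most \<open>- (\<delta>^2)\<close>, hence at most \<open>- \<delta>\<close>.\<close>
  have "0 \<le> \<delta>^3" "\<delta> \<le> \<delta>^2"
    using assms by (simp_all add: power2_eq_square)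
  then have "- (\<delta>^3) - \<delta>^2 \<le> - (4 / 27 * \<delta>)" using assms by linarith
  then have "(- \<delta>)^3 - (- \<delta>)^2 \<le> - (4 / 27 * \<delta>)" by simp
  moreover have "- (4 / 27 * \<delta>) \<le> 0^3 - 0^2" using assms by simp
  ultimately obtain \<alpha> where "\<alpha> \<in> cubic_solutions \<delta>"
    using cubic_solution_between[of "- \<delta>" 0 \<delta>] assms by auto
  moreover have "x = \<alpha>" if "x \<in> cubic_solutions \<delta>" for x
    using cubic_solutions_unique[OF that \<open>\<alpha> \<in> _\<close>] loc[OF that] loc[OF \<open>\<alpha> \<in> _\<close>] by simp
  ultimately have "cubic_solutions \<delta> = {\<alpha>}" by blast
  then show thesis using that loc by blast
qed

lemma cubic_solutions_one: "cubic_solutions 1 = {2/3, - (1/3)}"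
  by (auto simp: mem_cubic_solutions_iff_one)

lemma cubic_solutions_between_zero_one:
  assumes "0 < \<delta>" "\<delta> < 1"
  obtains \<alpha>\<^sub>1 \<alpha>\<^sub>2 \<alpha>\<^sub>3 where "cubic_solutions \<delta> = {\<alpha>\<^sub>1, \<alpha>\<^sub>2, \<alpha>\<^sub>3}"
    "0 < \<alpha>\<^sub>1" "\<alpha>\<^sub>1 < 2/3" "2/3 < \<alpha>\<^sub>2" "\<alpha>\<^sub>2 < 1" "- (1/3) < \<alpha>\<^sub>3" "\<alpha>\<^sub>3 < 0"
proof -
  \<comment> \<open>The intermediate value theorem only gives closed intervals; excluding their
    endpoints makes the bounds strict at the end.\<close>
  have ne: "x \<noteq> 0 \<and> x \<noteq> 1 \<and> x \<noteq> 2/3 \<and> x \<noteq> - (1/3)" if "x \<in> cubic_solutions \<delta>" for x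
  proof -
    have "x^2 * (x - 1) = - (4 / 27 * \<delta>)"
      using that mem_cubic_solutions_iff_zero by blast
    then have "x^2 * (x - 1) \<noteq> 0" using assms by linarith
    moreover have "(x - 2/3)^2 * (x + 1/3) = 4 / 27 * (1 - \<delta>)"
      using that mem_cubic_solutions_iff_one by blast
    then have "(x - 2/3)^2 * (x + 1/3) \<noteq> 0" using assms by (simp only:) simp
    ultimately show ?thesis by auto
  qed
  \<comment> \<open>At -1/3, 0, 2/3, 1 the cubic takes the values -4/27, 0, -4/27, 0, so each of the
    three intervals contains a solution.\<close>
  obtain \<alpha>\<^sub>1 where 1: "0 \<le> \<alpha>\<^sub>1" "\<alpha>\<^sub>1 \<le> 2/3" "\<alpha>\<^sub>1 \<in> cubic_solutions \<delta>"
    using cubic_solution_between[of 0 "2/3" \<delta>] assms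
    by (auto simp: power2_eq_square power3_eq_cube)
  obtain \<alpha>\<^sub>2 where 2: "2/3 \<le> \<alpha>\<^sub>2" "\<alpha>\<^sub>2 \<le> 1" "\<alpha>\<^sub>2 \<in> cubic_solutions \<delta>"
    using cubic_solution_between[of "2/3" 1 \<delta>] assms
    by (auto simp: power2_eq_square power3_eq_cube)
  obtain \<alpha>\<^sub>3 where 3: "- (1/3) \<le> \<alpha>\<^sub>3" "\<alpha>\<^sub>3 \<le> 0" "\<alpha>\<^sub>3 \<in> cubic_solutions \<delta>"
    using cubic_solution_between[of "- (1/3)" 0 \<delta>] assms
    by (auto simp: power2_eq_square power3_eq_cube)
  \<comment> \<open>Every \<open>x\<close> shares a branch with one of the three solutions
    found.\<close>
  have "x = \<alpha>\<^sub>1 \<or> x = \<alpha>\<^sub>2 \<or> x = \<alpha>\<^sub>3" if "x \<in> cubic_solutions \<delta>" for x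
    using cubic_solutions_unique[OF that 1(3)] cubic_solutions_unique[OF that 2(3)]
      cubic_solutions_unique[OF that 3(3)] 1 2 3 by fastforce
  then have "cubic_solutions \<delta> = {\<alpha>\<^sub>1, \<alpha>\<^sub>2, \<alpha>\<^sub>3}" using 1 2 3 by blast
  then show thesis
    by (rule that) (use 1 2 3 ne in \<open>force simp: less_le\<close>)+
qed

lemma cubic_solutions_zero: "cubic_solutions 0 = {0, 1}"
  by (auto simp: mem_cubic_solutions_iff_zero)

text \<open>By \<open>mem_cubic_solutions_iff_zero\<close> a solution makes
  \<open>x^2 * (x - 1)\<close> positive, so it exceeds 1 and lies on the last branch.\<close>

lemma cubic_solutions_neg:
  assumes "\<delta> < 0"
  obtains \<alpha> where "cubic_solutions \<delta> = {\<alpha>}" "1 < \<alpha>"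
proof -
  have loc: "1 < x" if "x \<in> cubic_solutions \<delta>" for x
  proof (rule ccontr)
    assume "\<not> 1 < x"
    then have "x^2 * (x - 1) \<le> 0" by (simp add: mult_nonneg_nonpos)
    then show False using that assms by (simp add: mem_cubic_solutions_iff_zero)
  qed
  \<comment> \<open>The right endpoint \<open>1 - \<delta>\<close> is chosen because its factor
    \<open>x - 1\<close> equals \<open>- \<delta>\<close>, while its square is at least 1.\<close>
  have "1 * (- \<delta>) \<le> (1 - \<delta>)^2 * (- \<delta>)"
    using assms by (intro mult_right_mono one_le_power) auto
  also have "\<dots> = (1 - \<delta>)^3 - (1 - \<delta>)^2"
    by (simp add: algebra_simps power2_eq_square power3_eq_cube)
  finally have "- (4 / 27 * \<delta>) \<le> (1 - \<delta>)^3 - (1 - \<delta>)^2" using assms by linarith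
  moreover have "1^3 - 1^2 \<le> - (4 / 27 * \<delta>)" using assms by simp
  ultimately obtain \<alpha> where "\<alpha> \<in> cubic_solutions \<delta>"
    using cubic_solution_between[of 1 "1 - \<delta>" \<delta>] assms by auto
  moreover have "x = \<alpha>" if "x \<in> cubic_solutions \<delta>" for x
    using cubic_solutions_unique[OF that \<open>\<alpha> \<in> _\<close>] loc[OF that] loc[OF \<open>\<alpha> \<in> _\<close>] by simp
  ultimately have "cubic_solutions \<delta> = {\<alpha>}" by blast
  then show thesis using that loc by blast
qed

theorem theorem1:
  fixes \<delta> :: real
  shows
    "(\<delta> > 1 \<longrightarrow>
        (\<exists>\<alpha>. cubic_solutions \<delta> = {\<alpha>} \<and> \<alpha> \<in> {..< - (1 / 3)})) \<and>
     (\<delta> = 1 \<longrightarrow>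
        card (cubic_solutions \<delta>) = 2 \<and> cubic_solutions \<delta> = {2 / 3, - (1 / 3)}) \<and>
     (0 < \<delta> \<and> \<delta> < 1 \<longrightarrow>
        card (cubic_solutions \<delta>) = 3 \<and>
        (\<exists>\<alpha>\<^sub>1 \<alpha>\<^sub>2 \<alpha>\<^sub>3. cubic_solutions \<delta> = {\<alpha>\<^sub>1, \<alpha>\<^sub>2, \<alpha>\<^sub>3} \<and>
           0 < \<alpha>\<^sub>1 \<and> \<alpha>\<^sub>1 < 2 / 3 \<and> 2 / 3 < \<alpha>\<^sub>2 \<and> \<alpha>\<^sub>2 < 1 \<and> \<alpha>\<^sub>3 \<in> {- (1 / 3) <..< 0})) \<and>
     (\<delta> = 0 \<longrightarrow>
        card (cubic_solutions \<delta>) = 2 \<and> cubic_solutions \<delta> = {0, 1}) \<and>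
     (\<delta> < 0 \<longrightarrow>
        (\<exists>\<alpha>. cubic_solutions \<delta> = {\<alpha>} \<and> \<alpha> \<in> {1 <..}))"
proof (intro conjI impI)
  assume "\<delta> > 1"
  then show "\<exists>\<alpha>. cubic_solutions \<delta> = {\<alpha>} \<and> \<alpha> \<in> {..< - (1 / 3)}"
    using cubic_solutions_gt_one[of \<delta>] by (metis lessThan_iff)
next
  assume d: "0 < \<delta> \<and> \<delta> < 1"
  obtain \<alpha>\<^sub>1 \<alpha>\<^sub>2 \<alpha>\<^sub>3 where sols: "cubic_solutions \<delta> = {\<alpha>\<^sub>1, \<alpha>\<^sub>2, \<alpha>\<^sub>3}"
    and loc: "0 < \<alpha>\<^sub>1" "\<alpha>\<^sub>1 < 2/3" "2/3 < \<alpha>\<^sub>2" "\<alpha>\<^sub>2 < 1" "- (1/3) < \<alpha>\<^sub>3" "\<alpha>\<^sub>3 < 0"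
    using cubic_solutions_between_zero_one[of \<delta>] d by metis
  show "card (cubic_solutions \<delta>) = 3"
    unfolding sols using loc by (simp add: card_insert_if)
  show "\<exists>\<alpha>\<^sub>1 \<alpha>\<^sub>2 \<alpha>\<^sub>3. cubic_solutions \<delta> = {\<alpha>\<^sub>1, \<alpha>\<^sub>2, \<alpha>\<^sub>3} \<and>
      0 < \<alpha>\<^sub>1 \<and> \<alpha>\<^sub>1 < 2 / 3 \<and> 2 / 3 < \<alpha>\<^sub>2 \<and> \<alpha>\<^sub>2 < 1 \<and> \<alpha>\<^sub>3 \<in> {- (1 / 3) <..< 0}"
    using sols loc by (metis greaterThanLessThan_iff)
next
  assume "\<delta> < 0"
  then show "\<exists>\<alpha>. cubic_solutions \<delta> = {\<alpha>} \<and> \<alpha> \<in> {1 <..}"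
    using cubic_solutions_neg[of \<delta>] by (metis greaterThan_iff)
qed (simp_all add: cubic_solutions_one cubic_solutions_zero)

end
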